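(* Let $\mathfrak{S}\subset\mathbb{Z}^2$ be a set of steps that is well-ordered in the reverse lexicographic ordering. Let $p$ be the smallest positive integer such that there is an $\mathfrak{S}$-path (starting at $(0,0)$) ending at $(p,0)$. Then for every $n\ge1$, the number of walks on the half plane avoiding the half line that have steps in $\mathfrak S$, end at $(p,0)$ and have length $n$ equals $\frac1n$ times the number of $\mathfrak{S}$-paths that end at $(p,0)$ and have length $n$.
   Context: Reverse lexicographic ordering on $\mathbb{Z}^2$: $(a,b)<(c,d)$ iff $b<d$, or $b=d$ and $a<c$. An $\mathfrak{S}$-path of length $n$ is a sequence of $n$ steps $s_1,\dots,s_n\in\mathfrak{S}$, viewed as the lattice path in $\mathbb{Z}^2$ starting at $(0,0)$ and visiting the partial sums $s_1+\dots+s_i$; well-orderedness of $\mathfrak S$ guarantees that the number of paths of given length and endpoint is finite. A walk on the half plane avoiding the half line is an $\mathfrak{S}$-path that never visits a point $(i,j)$ with $j<0$ and, after its starting point, never visits a point of $\{(-k,0):k\ge0\}$. *)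

theory Defs
  imports Complex_Main "HOL-Library.Product_Plus" "HOL-Library.Ramsey"
begin

definition revlex_less :: "int \<times> int \<Rightarrow> int \<times> int \<Rightarrow> bool" where
  "revlex_less x y \<longleftrightarrow> snd x < snd y \<or> (snd x = snd y \<and> fst x < fst y)"

definition revlex :: "(int \<times> int) rel" where
  "revlex = {(x, y). x = y \<or> revlex_less x y}"

definition position :: "(int \<times> int) list \<Rightarrow> nat \<Rightarrow> int \<times> int" where
  "position s i = sum_list (take i s)"

definition paths :: "(int \<times> int) set \<Rightarrow> nat \<Rightarrow> int \<times> int \<Rightarrow> (int \<times> int) list set" where
  "paths S n e = {s. length s = n \<and> set s \<subseteq> S \<and> position s n = e}"

definition half_line :: "(int \<times> int) set" where
  "half_line = {(- k, 0) | k. k \<ge> 0}"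

definition avoiding_walks ::
    "(int \<times> int) set \<Rightarrow> nat \<Rightarrow> int \<times> int \<Rightarrow> (int \<times> int) list set" where
  "avoiding_walks S n e =
     {s \<in> paths S n e. (\<forall>i\<le>n. \<not> snd (position s i) < 0) \<and>
                       (\<forall>i\<in>{1..n}. position s i \<notin> half_line)}"

lemma revlex_sum_list_less:
  assumes "length s = length t" "\<And>i. i < length s \<Longrightarrow> (t ! i, s ! i) \<in> revlex" "s \<noteq> t"
  shows "revlex_less (sum_list t) (sum_list s)"
  using assms
proof (induction s t rule: list_induct2)
  case (Cons x xs y ys)
  have hd: "(y, x) \<in> revlex" using Cons.prems(1)[of 0] by simp
  have tl: "\<And>i. i < length xs \<Longrightarrow> (ys ! i, xs ! i) \<in> revlex"
    using Cons.prems(1)[of "Suc _"] by simp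
  show ?case
  proof (cases "xs = ys")
    case True
    then show ?thesis using hd Cons.prems(2) by (auto simp: revlex_def revlex_less_def)
  next
    case False
    then show ?thesis using hd Cons.IH[OF tl False] by (auto simp: revlex_def revlex_less_def)
  qed
qed simp

text \<open>Cardinalities of infinite sets are 0 in HOL; the following shows that the counts of
  paths and walks with steps in a well-ordered set are genuine.\<close>

lemma finite_paths:
  assumes "well_order_on S (Restr revlex S)"
  shows "finite (paths S n e)"
proof (rule ccontr)
  assume "infinite (paths S n e)"
  then obtain f :: "nat \<Rightarrow> (int \<times> int) list" where f: "inj f" "range f \<subseteq> paths S n e"
    using infinite_countable_subset by blast
  have "f k \<in> paths S n e" for k
    using f(2) by blast
  then have len: "length (f k) = n" and st: "set (f k) \<subseteq> S" and sm: "sum_list (f k) = e" for k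
    by (simp_all add: paths_def position_def) (metis order_refl take_all)
  define T where "T i = {(b, a). a < b \<and> (f b ! i, f a ! i) \<in> Restr revlex S - Id}" for i
  have wfT: "wf (T i)" for i
  proof (rule wf_subset)
    show "wf (inv_image (Restr revlex S - Id) (\<lambda>k. f k ! i))"
      using assms by (intro wf_inv_image) (simp add: well_order_on_def)
  qed (auto simp: T_def)
  have "{(b, a). a < b} = (\<Union>i<n. T i)"
  proof (intro equalityI subsetI)
    fix z :: "nat \<times> nat" assume "z \<in> {(b, a). a < b}"
    then obtain a b where z: "z = (b, a)" "a < b" by auto
    have ne: "f b \<noteq> f a" using f(1) z(2) by (auto dest: injD)
    have "\<exists>i<n. revlex_less (f b ! i) (f a ! i)"
    proof (rule ccontr)
      assume "\<not> ?thesis"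
      then have "(f a ! i, f b ! i) \<in> revlex" if "i < n" for i
        using that by (fastforce simp: revlex_def revlex_less_def prod_eq_iff)
      then have "revlex_less (sum_list (f a)) (sum_list (f b))"
        using revlex_sum_list_less[of "f b" "f a"] ne len by simp
      then show False by (simp add: sm revlex_less_def)
    qed
    then obtain i where i: "i < n" "revlex_less (f b ! i) (f a ! i)" by blast
    have "f b ! i \<in> S" "f a ! i \<in> S" using i(1) st len by (metis nth_mem subsetD)+
    then have "z \<in> T i" using z i by (auto simp: T_def revlex_def revlex_less_def)
    then show "z \<in> (\<Union>i<n. T i)" using i by blast
  qed (auto simp: T_def)
  then have "disj_wf {(b, a :: nat). a < b}"
    unfolding disj_wf_def using wfT by blast
  moreover have "trans {(b, a :: nat). a < b}" by (auto simp: trans_def)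
  ultimately have "wf {(b, a :: nat). a < b}"
    by (rule trans_disj_wf_implies_wf[rotated])
  then show False
    unfolding wf_iff_no_infinite_down_chain by (auto dest: spec[of _ "\<lambda>k. k"])
qed

lemma finite_avoiding_walks:
  "well_order_on S (Restr revlex S) \<Longrightarrow> finite (avoiding_walks S n e)"
  by (rule finite_subset[OF _ finite_paths]) (auto simp: avoiding_walks_def)

end

theory Submission
  imports Defs
begin

text \<open>This is an instance of the cycle lemma. Extend the partial sums of a path of length \<open>n\<close> to
  \<open>(p, 0)\<close> by periodicity, \<open>x (i + n) = x i + (p, 0)\<close>. The cyclic shift of the path by \<open>k\<close> is an
  avoiding walk iff \<open>x k < x (k + i)\<close> in the reverse lexicographic ordering for \<open>1 \<le> i \<le> n\<close>.
  The last minimum of \<open>x\<close> on one period has this property. If \<open>k < k' < n\<close> both had it, then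
  \<open>x k < x k' < x k + (p, 0)\<close>, so that the steps in between form a path to \<open>(q, 0)\<close> with
  \<open>0 < q < p\<close>. Hence exactly one of the \<open>n\<close> cyclic shifts of every path is an avoiding walk.\<close>

lemma in_pathsI: "set s \<subseteq> S \<Longrightarrow> s \<in> paths S (length s) (sum_list s)"
  by (simp add: paths_def position_def)

lemma paths_iff: "s \<in> paths S n e \<longleftrightarrow> length s = n \<and> set s \<subseteq> S \<and> sum_list s = e"
  by (auto simp: paths_def position_def)

text \<open>A cyclic shift is a window of \<open>s @ s\<close>; with two periods at hand, no index
  has to be reduced modulo the length.\<close>

lemma take_rotate_eq_take_drop_append:
  assumes "k \<le> length s" "i \<le> length s"
  shows "take i (rotate k s) = take i (drop k (s @ s))"
proof (cases "k = length s")
  case False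
  then show ?thesis using assms by (simp add: rotate_drop_take)
qed (simp add: assms)

lemma sum_list_take_rotate:
  fixes s :: "'a::ab_group_add list"
  assumes "k \<le> length s" "i \<le> length s"
  shows "sum_list (take i (rotate k s)) = sum_list (take (k + i) (s @ s)) - sum_list (take k (s @ s))"
  by (simp only: take_rotate_eq_take_drop_append[OF assms] take_add sum_list_append) simp

lemma rotate_in_paths_iff [simp]: "rotate k s \<in> paths S n e \<longleftrightarrow> s \<in> paths S n e"
proof -
  have "sum_list (rotate k s) = sum_list s"
  proof (induction k)
    case (Suc k)
    have "sum_list (rotate1 t) = sum_list t" for t :: "(int \<times> int) list"
      by (cases t) (simp_all add: add.commute)
    then show ?case using Suc by simp
  qed simp
  then show ?thesis by (simp add: paths_iff)
qed

text \<open>The points outside both the open lower half plane and the half line are exactly those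
  above the origin in the ordering. Index 0 imposes nothing, since the path starts at the
  origin.\<close>

lemma avoiding_walks_iff:
  "s \<in> avoiding_walks S n e \<longleftrightarrow>
     s \<in> paths S n e \<and> (\<forall>i\<in>{1..n}. revlex_less (0, 0) (position s i))"
proof -
  have half: "x \<in> half_line \<longleftrightarrow> snd x = 0 \<and> fst x \<le> 0" for x
    by (auto simp: half_line_def prod_eq_iff intro: exI[of _ "- fst x"])
  have "revlex_less (0, 0) x \<longleftrightarrow> \<not> snd x < 0 \<and> x \<notin> half_line" for x
    by (auto simp: half revlex_less_def)
  moreover have "(\<forall>i\<le>n. \<not> snd (position s i) < 0) \<longleftrightarrow> (\<forall>i\<in>{1..n}. \<not> snd (position s i) < 0)"
    by (force simp: position_def Suc_le_eq)
  ultimately show ?thesis by (auto simp: avoiding_walks_def)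
qed

lemma revlex_less_diff_iff: "revlex_less (0, 0) (y - x) \<longleftrightarrow> revlex_less x y"
  by (auto simp: revlex_less_def)

lemma rotate_avoiding_iff:
  assumes "s \<in> paths S n e" "k \<le> n"
  shows "rotate k s \<in> avoiding_walks S n e \<longleftrightarrow>
    (\<forall>i\<in>{1..n}. revlex_less (sum_list (take k (s @ s))) (sum_list (take (k + i) (s @ s))))"
proof -
  have "position (rotate k s) i = sum_list (take (k + i) (s @ s)) - sum_list (take k (s @ s))"
    if "i \<le> n" for i
    using that assms by (simp add: position_def sum_list_take_rotate paths_iff del: take_append)
  then show ?thesis
    using assms by (simp add: avoiding_walks_iff revlex_less_diff_iff del: take_append)
qed

lemma ex_last_revlex_min:
  fixes x :: "nat \<Rightarrow> int \<times> int"
  assumes "n \<ge> 1"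
  obtains k where "k < n" "\<And>i. k < i \<Longrightarrow> i < n \<Longrightarrow> revlex_less (x k) (x i)"
    "\<And>i. i < n \<Longrightarrow> (x k, x i) \<in> revlex"
proof -
  \<comment> \<open>Ties are broken in favour of the larger index, so an \<open>R\<close>-minimal
    index is the last minimum of \<open>x\<close>. This makes the comparison with later indices
    strict.\<close>
  define R where "R i j \<longleftrightarrow> revlex_less (x i) (x j) \<or> x i = x j \<and> j < i" for i j
  have "\<exists>k\<in>{..<n}. \<forall>i\<in>{..<n}. i \<noteq> k \<longrightarrow> \<not> R i k"
  proof (rule Finite_Set.bex_min_element)
    show "transp_on {..<n} R" "asymp_on {..<n} R"
      by (auto simp: transp_on_def asymp_on_def R_def revlex_less_def prod_eq_iff)
    show "{..<n} \<noteq> {}" using assms by (auto simp: lessThan_empty_iff)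
  qed simp
  then obtain k where k: "k < n" "\<And>i. i < n \<Longrightarrow> i \<noteq> k \<Longrightarrow> \<not> R i k" by auto
  show thesis
  proof
    show "revlex_less (x k) (x i)" if "k < i" "i < n" for i
      using k(2)[of i] that by (auto simp: R_def revlex_less_def prod_eq_iff)
    show "(x k, x i) \<in> revlex" if "i < n" for i
      using k(2)[of i] that
      by (cases "i = k") (auto simp: R_def revlex_def revlex_less_def prod_eq_iff)
  qed fact
qed

lemma ex_rotate_avoiding:
  assumes "s \<in> paths S n (p, 0)" "p > 0" "n \<ge> 1"
  shows "\<exists>k<n. rotate k s \<in> avoiding_walks S n (p, 0)"
proof -
  define x where "x i = sum_list (take i (s @ s))" for i
  have per: "x (n + i) = (p, 0) + x i" if "i \<le> n" for i
    using assms(1) that by (simp add: x_def paths_iff)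
  obtain k where k: "k < n" "\<And>i. k < i \<Longrightarrow> i < n \<Longrightarrow> revlex_less (x k) (x i)"
    "\<And>i. i < n \<Longrightarrow> (x k, x i) \<in> revlex"
    using ex_last_revlex_min[OF assms(3)] by blast
  have "revlex_less (x k) (x (k + i))" if "i \<in> {1..n}" for i
  proof (cases "k + i < n")
    case True
    then show ?thesis using k(2) that by simp
  next
    case False
    \<comment> \<open>Past the end of the period, only the weak inequality \<open>x k\<close> \<le>
      \<open>x (k + i - n)\<close> is available; the shift by \<open>(p, 0)\<close> with
      \<open>p > 0\<close> makes it strict.\<close>
    then have j: "k + i = n + (k + i - n)" "k + i - n < n" using that k(1) by auto
    have "x (k + i) = (p, 0) + x (k + i - n)"
      using per[of "k + i - n"] j by simp
    then show ?thesis using k(3)[OF j(2)] assms(2)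
      by (auto simp: revlex_def revlex_less_def)
  qed
  then show ?thesis
    using rotate_avoiding_iff[OF assms(1), of k] k(1) by (auto simp: x_def simp del: take_append)
qed

lemma rotate_avoiding_unique:
  assumes s: "s \<in> paths S n (p, 0)"
    and min: "\<forall>q m. q > 0 \<longrightarrow> paths S m (q, 0) \<noteq> {} \<longrightarrow> p \<le> q"
    and kl: "k < l" "l < n"
    and av: "rotate k s \<in> avoiding_walks S n (p, 0)" "rotate l s \<in> avoiding_walks S n (p, 0)"
  shows False
proof -
  define x where "x i = sum_list (take i (s @ s))" for i
  have per: "x (n + i) = (p, 0) + x i" if "i \<le> n" for i
    using s that by (simp add: x_def paths_iff)
  define t where "t = take (l - k) (drop k (s @ s))"
  have "set t \<subseteq> set (s @ s)"
    unfolding t_def by (blast dest: in_set_takeD in_set_dropD)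
  then have "set t \<subseteq> S"
    using s by (auto simp: paths_iff)
  moreover have "x l = x k + sum_list t"
    using kl(1) take_add[of k "l - k" "s @ s"] by (simp add: x_def t_def del: take_append)
  ultimately have t: "t \<in> paths S (length t) (x l - x k)"
    using in_pathsI[of t S] by simp
  have "\<forall>i\<in>{1..n}. revlex_less (x k) (x (k + i))"
    using av(1) rotate_avoiding_iff[OF s, of k] kl by (simp add: x_def del: take_append)
  moreover have "l - k \<in> {1..n}" using kl by auto
  ultimately have "revlex_less (x k) (x (k + (l - k)))" ..
  then have 1: "revlex_less (x k) (x l)" using kl by simp
  have "\<forall>i\<in>{1..n}. revlex_less (x l) (x (l + i))"
    using av(2) rotate_avoiding_iff[OF s, of l] kl by (simp add: x_def del: take_append)
  \<comment> \<open>This many steps lead from index \<open>l\<close> to \<open>n + k\<close>, one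
    period after \<open>k\<close>.\<close>
  moreover have "n + k - l \<in> {1..n}" using kl by auto
  ultimately have "revlex_less (x l) (x (l + (n + k - l)))" ..
  then have 2: "revlex_less (x l) ((p, 0) + x k)" using kl per[of k] by simp
  \<comment> \<open>The bounds \<open>x k\<close> and \<open>x k + (p, 0)\<close> have the same
    second coordinate, which forces it on \<open>x l\<close> as well; the first coordinates are then
    strictly ordered.\<close>
  have "x l - x k = (fst (x l) - fst (x k), 0)" "fst (x l) - fst (x k) > 0"
    "fst (x l) - fst (x k) < p"
    using 1 2 by (auto simp: revlex_less_def prod_eq_iff)
  then show False
    using min[rule_format, of "fst (x l) - fst (x k)" "length t"] t by auto
qed

text \<open>Rotation by \<open>k\<close> permutes the paths, with rotation by \<open>n - k\<close>
  as its inverse, so the count does not depend on \<open>k\<close>.\<close>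

lemma card_rotate_avoiding:
  assumes "k \<le> n"
  shows "card {s \<in> paths S n e. rotate k s \<in> avoiding_walks S n e} = card (avoiding_walks S n e)"
proof (rule bij_betw_same_card)
  have sub: "avoiding_walks S n e \<subseteq> paths S n e"
    by (auto simp: avoiding_walks_def)
  have len: "length s = n" if "s \<in> paths S n e" for s
    using that by (simp add: paths_iff)
  show "bij_betw (rotate k) {s \<in> paths S n e. rotate k s \<in> avoiding_walks S n e}
      (avoiding_walks S n e)"
    using sub assms
    by (intro bij_betw_byWitness[where f' = "rotate (n - k)"])
      (auto simp: rotate_rotate rotate_id len subset_iff)
qed

theorem mainTheorem6:
  fixes S :: "(int \<times> int) set" and p :: int and n :: nat
  assumes "well_order_on S (Restr revlex S)"
    and "p > 0" and "\<exists>m. paths S m (p, 0) \<noteq> {}"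
    and "\<And>q m. q > 0 \<Longrightarrow> paths S m (q, 0) \<noteq> {} \<Longrightarrow> p \<le> q"
    and "n \<ge> 1"
  shows "real (card (avoiding_walks S n (p, 0))) = 1 / real n * real (card (paths S n (p, 0)))"
proof -
  let ?P = "paths S n (p, 0)" and ?A = "avoiding_walks S n (p, 0)"
  have min: "\<forall>q m. q > 0 \<longrightarrow> paths S m (q, 0) \<noteq> {} \<longrightarrow> p \<le> q"
    by (intro allI impI) (erule (1) assms(4))
  have "card {k \<in> {..<n}. rotate k s \<in> ?A} = 1" if s: "s \<in> ?P" for s
  proof -
    obtain k where k: "k < n" "rotate k s \<in> ?A"
      using ex_rotate_avoiding[OF s assms(2,5)] by blast
    have "l = k" if "l < n" "rotate l s \<in> ?A" for l
      using rotate_avoiding_unique[OF s min] k that by (meson nat_neq_iff)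
    then have "{k \<in> {..<n}. rotate k s \<in> ?A} = {k}" using k by blast
    then show ?thesis by simp
  qed
  \<comment> \<open>Double counting of the pairs of a shift \<open>k\<close> and a path
    \<open>s\<close> for which \<open>rotate k s\<close> is avoiding: each path occurs in exactly
    one pair.\<close>
  then have "(\<Sum>k<n. card {s \<in> ?P. rotate k s \<in> ?A}) = 1 * card ?P"
    using finite_paths[OF assms(1)] by (intro sum_multicount) auto
  then have "n * card ?A = card ?P"
    by (simp add: card_rotate_avoiding)
  then have "real n * real (card ?A) = real (card ?P)"
    by (metis of_nat_mult)
  then show ?thesis
    using assms(5) by (simp add: field_simps)
qed

end
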